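(* Let $q$ be a prime power and let $L_U$ be a linear set of $\mathrm{PG}(1,q^5)$ belonging to one of the families $(C3)$ or $(C4)$ (defined in the context). Then there exist $\varepsilon\in\{0,1\}$ and $\gamma\in\mathbb{F}_{q^5}^*$ such that $L_U$ is projectively equivalent to $L^\varepsilon_\gamma:=L_{W^\varepsilon_\gamma}$, where \[ W^0_\gamma=\{(x,x^q+\gamma h): x\in\mathbb{F}_{q^5},\ \mathrm{Tr}_{q^5/q}(x)=0,\ h\in\mathbb{F}_q\} \] and \[ W^1_\gamma=\{(x,x^q+\gamma\,\mathrm{Tr}_{q^5/q}(x)): x\in\mathbb{F}_{q^5}\}. \]
   Context: For an $\mathbb{F}_q$-subspace $U$ of $\mathbb{F}_{q^5}^2$, $L_U=\{\langle \mathbf{u}\rangle_{\mathbb{F}_{q^5}}:\mathbf{u}\in U\setminus\{\mathbf 0\}\}\subseteq\mathrm{PG}(1,q^5)$ is the $\mathbb{F}_q$-linear set defined by $U$. Two linear sets are projectively equivalent if an element of $\mathrm{PGL}(2,q^5)$ maps one (as a point set) onto the other. $\mathrm{Tr}_{q^5/q}(x)=x+x^q+x^{q^2}+x^{q^3}+x^{q^4}$ and $\mathrm{N}_{q^5/q}(x)=x^{1+q+q^2+q^3+q^4}$. Family $(C3)$: the linear sets $L_U$ with $U=\{(\eta(x^q-x)+\mathrm{Tr}_{q^5/q}(\rho x),\ x^q-x^{q^4}):x\in\mathbb{F}_{q^5}\}$, where $\eta,\rho\in\mathbb{F}_{q^5}^*$ and $\mathrm{Tr}_{q^5/q}(\eta)=0\ne\mathrm{Tr}_{q^5/q}(\rho)$.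 Family $(C4)$: the linear sets $L_U$ with $U=\{(x,\ k(x^q+x^{q^3})+x^{q^2}+x^{q^4}):x\in\mathbb{F}_{q^5}\}$, where $k\in\mathbb{F}_{q^5}$, $\mathrm{N}_{q^5/q}(k)=1$ and $k\neq1$. *)

theory Defs
  imports "HOL-Analysis.Analysis" "HOL-Number_Theory.Prime_Powers"
begin

text \<open>
  Throughout, \<^typ>\<open>'a\<close> is a field with \<open>q\<^sup>5\<close> elements. Its subfield of order \<open>q\<close> is the set
  of fixed points of the map \<open>x \<mapsto> x\<^sup>q\<close>. Points of the projective line over \<^typ>\<open>'a\<close> are the
  one-dimensional subspaces of \<^typ>\<open>'a ^ 2\<close>, represented as sets of vectors.
\<close>

definition Fq :: "nat \<Rightarrow> 'a::field set" where
  "Fq q = {h. h ^ q = h}"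

definition Tr :: "nat \<Rightarrow> 'a::field \<Rightarrow> 'a" where
  "Tr q x = x + x ^ q + x ^ (q ^ 2) + x ^ (q ^ 3) + x ^ (q ^ 4)"

definition Nm :: "nat \<Rightarrow> 'a::field \<Rightarrow> 'a" where
  "Nm q x = x ^ (1 + q + q ^ 2 + q ^ 3 + q ^ 4)"

definition Fq_subspace :: "nat \<Rightarrow> ('a::field ^ 2) set \<Rightarrow> bool" where
  "Fq_subspace q U \<longleftrightarrow>
     0 \<in> U \<and> (\<forall>u\<in>U. \<forall>v\<in>U. u + v \<in> U) \<and> (\<forall>c\<in>Fq q. \<forall>u\<in>U. c *s u \<in> U)"

definition linear_set :: "('a::field ^ 2) set \<Rightarrow> ('a ^ 2) set set" where
  "linear_set U = {vec.span {u} | u. u \<in> U - {0}}"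

text \<open>
  An element of \<open>PGL(2)\<close> is the class of an invertible matrix modulo nonzero scalars; it acts on
  points through any representative \<open>A\<close>.
\<close>

definition proj_equiv :: "('a::field ^ 2) set set \<Rightarrow> ('a ^ 2) set set \<Rightarrow> bool" where
  "proj_equiv L L' \<longleftrightarrow> (\<exists>A :: 'a ^ 2 ^ 2. invertible A \<and> (\<lambda>P. (*v) A ` P) ` L = L')"

definition U_C3 :: "nat \<Rightarrow> 'a::field \<Rightarrow> 'a \<Rightarrow> ('a ^ 2) set" where
  "U_C3 q \<eta> \<rho> = {vector [\<eta> * (x ^ q - x) + Tr q (\<rho> * x), x ^ q - x ^ (q ^ 4)] | x. True}"

definition family_C3 :: "nat \<Rightarrow> ('a::field ^ 2) set set set" where
  "family_C3 q = {linear_set (U_C3 q \<eta> \<rho>) | \<eta> \<rho>.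
     \<eta> \<noteq> 0 \<and> \<rho> \<noteq> 0 \<and> Tr q \<eta> = 0 \<and> Tr q \<rho> \<noteq> 0}"

definition U_C4 :: "nat \<Rightarrow> 'a::field \<Rightarrow> ('a ^ 2) set" where
  "U_C4 q k = {vector [x, k * (x ^ q + x ^ (q ^ 3)) + x ^ (q ^ 2) + x ^ (q ^ 4)] | x. True}"

definition family_C4 :: "nat \<Rightarrow> ('a::field ^ 2) set set set" where
  "family_C4 q = {linear_set (U_C4 q k) | k. Nm q k = 1 \<and> k \<noteq> 1}"

definition W0 :: "nat \<Rightarrow> 'a::field \<Rightarrow> ('a ^ 2) set" where
  "W0 q \<gamma> = {vector [x, x ^ q + \<gamma> * h] | x h. Tr q x = 0 \<and> h \<in> Fq q}"

definition W1 :: "nat \<Rightarrow> 'a::field \<Rightarrow> ('a ^ 2) set" where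
  "W1 q \<gamma> = {vector [x, x ^ q + \<gamma> * Tr q x] | x. True}"

definition W :: "nat \<Rightarrow> nat \<Rightarrow> 'a::field \<Rightarrow> ('a ^ 2) set" where
  "W q \<epsilon> \<gamma> = (if \<epsilon> = 0 then W0 q \<gamma> else W1 q \<gamma>)"

end

theory Submission
  imports Defs "HOL-Number_Theory.Residues"
begin

text \<open>
  Write \<open>\<sigma>\<close> for \<open>x \<mapsto> x\<^sup>q\<close> and, for \<open>c \<in> F\<^sub>q\<close>, let
  \<open>V(c, \<gamma>) = {(u, \<sigma> u + \<gamma> t) | t \<in> F\<^sub>q, Tr u = c t}\<close>. If \<open>c = 0\<close> this is \<open>W\<^sup>0\<^sub>\<gamma>\<close>; otherwise
  \<open>t = Tr u / c\<close> and it is \<open>W\<^sup>1\<close> with parameter \<open>\<gamma> / c\<close>. Both families are carried onto some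
  \<open>V(c, \<gamma>)\<close> by an explicit matrix.

  In \<open>(C3)\<close> put \<open>e = 1 / \<eta>\<close>, \<open>y = \<sigma> x - x\<close> and \<open>h = Tr (\<rho> x)\<close>; since \<open>Tr \<rho> \<noteq> 0\<close>, the pair \<open>(y, h)\<close>
  runs through all of \<open>ker Tr \<times> F\<^sub>q\<close>. With \<open>u = e h - \<sigma>\<^sup>4 y\<close> one finds \<open>Tr u = h Tr e\<close> and
  \<open>-(y + e h) = \<sigma> u - (e + \<sigma> e) h\<close>.

  In \<open>(C4)\<close> put \<open>d = 1 / (k - 1)\<close>. Adding \<open>x\<close> to the second coordinate and multiplying by \<open>d\<close> gives
  \<open>u = \<sigma> x + \<sigma>\<^sup>3 x + d Tr x\<close>, for which \<open>x + u + \<sigma> u = (1 + d + \<sigma> d) Tr x\<close> and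
  \<open>Tr u = (2 + Tr d) Tr x\<close>.

  The remaining conditions on \<open>\<eta>\<close> and \<open>k\<close> only serve to make \<open>\<gamma>\<close> nonzero.
\<close>

section \<open>Powers in a finite field\<close>

lemma power_CARD_eq_self:
  fixes x :: "'a::{field, finite}"
  shows "x ^ CARD('a) = x"
proof (cases "x = 0")
  case False
  \<comment> \<open>Multiplication by \<open>x\<close> permutes the nonzero elements, so their
    product is unchanged by a factor \<open>x ^ (CARD('a) - 1)\<close>.\<close>
  have "bij_betw ((*) x) (UNIV - {0}) (UNIV - {0})"
    using False by (intro bij_betw_byWitness[where f' = "\<lambda>y. y / x"]) auto
  then have "(\<Prod>y\<in>UNIV - {0}. x * y) = \<Prod>(UNIV - {0 :: 'a})"
    by (rule prod.reindex_bij_betw)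
  then have "x ^ (CARD('a) - 1) = 1"
    by (simp add: prod.distrib card_Diff_singleton)
  moreover have "x ^ CARD('a) = x * x ^ (CARD('a) - 1)"
    by (simp add: power_eq_if)
  ultimately show ?thesis
    by simp
qed (simp add: power_0_left)

text \<open>The characteristic is a prime dividing a power of \<open>p\<close>, hence is
  \<open>p\<close> itself; so \<open>q\<close> is a power of the characteristic.\<close>

lemma power_add_finite_field:
  fixes x y :: "'a::{field, finite}"
  assumes "primepow q" "CARD('a) = q ^ n"
  shows "(x + y) ^ q = x ^ q + y ^ q"
proof -
  obtain p m where p: "prime p" "q = p ^ m"
    using assms(1) by (auto simp: primepow_def)
  have prime: "prime CHAR('a)"
    by (intro prime_CHAR_semidom finite_imp_CHAR_pos finite)
  have "CHAR('a) dvd p ^ (m * n)"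
    using CHAR_dvd_CARD[where 'a = 'a] assms(2) p(2) by (simp add: power_mult)
  then have "CHAR('a) = p"
    using prime p(1) by (intro primes_dvd_imp_eq prime_dvd_power[of _ p "m * n"])
  then show ?thesis
    using freshmans_dream'[OF prime, of q m x y] p(2) by simp
qed

section \<open>Projective maps acting on linear sets\<close>

lemma linear_set_matrix_image:
  fixes A :: "'a::field ^ 2 ^ 2"
  assumes "invertible A"
  shows "linear_set ((*v) A ` U) = (\<lambda>P. (*v) A ` P) ` linear_set U"
proof -
  have inj: "A *v u = 0 \<longleftrightarrow> u = 0" for u
    using inj_matrix_vector_mult[OF assms] by (metis injD matrix_vector_mult_0_right)
  have span: "vec.span {A *v u} = (*v) A ` vec.span {u}" for u
    using vec.linear_span_image[OF matrix_vector_mul_linear_gen, of A "{u}"] by simp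
  show ?thesis
    unfolding linear_set_def
    by (auto simp: inj span image_iff) (use inj span in blast)+
qed

text \<open>The last two premises are the two inclusions between \<open>Y\<close> and the image of
  \<open>X\<close> under the matrix with rows \<open>(a, b)\<close> and
  \<open>(c, d)\<close>.\<close>

lemma proj_equiv_linear_setI:
  fixes X Y :: "('a::field ^ 2) set"
  assumes det: "a * d - b * c \<noteq> 0"
    and "\<And>x y. vector [x, y] \<in> X \<Longrightarrow> vector [a * x + b * y, c * x + d * y] \<in> Y"
    and "\<And>v. v \<in> Y \<Longrightarrow> \<exists>x y. vector [x, y] \<in> X \<and> v = vector [a * x + b * y, c * x + d * y]"
  shows "proj_equiv (linear_set X) (linear_set Y)"
proof -
  define A :: "'a ^ 2 ^ 2" where "A = vector [vector [a, b], vector [c, d]]"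
  have A: "A *v vector [x, y] = vector [a * x + b * y, c * x + d * y]" for x y
    by (simp add: A_def vec_eq_iff forall_2 matrix_vector_mult_def sum_2)
  have vec: "vector [v $ 1, v $ 2] = v" for v :: "'a ^ 2"
    by (simp add: vec_eq_iff forall_2)
  have inv: "invertible A"
    using det by (simp add: invertible_det_nz det_2 A_def)
  have "(*v) A ` X = Y"
  proof
    show "(*v) A ` X \<subseteq> Y"
      using assms(2) A vec by (metis image_subsetI)
    show "Y \<subseteq> (*v) A ` X"
      using assms(3) A by (metis image_eqI subsetI)
  qed
  then show ?thesis
    unfolding proj_equiv_def using linear_set_matrix_image[OF inv, of X] inv by metis
qed

section \<open>Frobenius map and trace\<close>

locale quintic_frobenius =
  fixes q :: nat and \<sigma> :: "'a::field \<Rightarrow> 'a"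
  defines "\<sigma> \<equiv> \<lambda>x. x ^ q"
  assumes q_pos: "q > 0"
    and power_add: "\<And>x y :: 'a. (x + y) ^ q = x ^ q + y ^ q"
    and power_q5: "\<And>x :: 'a. x ^ (q ^ 5) = x"
begin

lemma frob_add [simp]: "\<sigma> (x + y) = \<sigma> x + \<sigma> y"
  by (simp add: \<sigma>_def power_add)

lemma frob_mult [simp]: "\<sigma> (x * y) = \<sigma> x * \<sigma> y"
  by (simp add: \<sigma>_def power_mult_distrib)

lemma frob_0 [simp]: "\<sigma> 0 = 0"
  using q_pos by (simp add: \<sigma>_def)

lemma frob_1 [simp]: "\<sigma> 1 = 1"
  by (simp add: \<sigma>_def)

lemma frob_minus [simp]: "\<sigma> (- x) = - \<sigma> x"
  using frob_add[of x "- x"] by (simp add: eq_neg_iff_add_eq_0 add.commute)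

lemma frob_diff [simp]: "\<sigma> (x - y) = \<sigma> x - \<sigma> y"
  using frob_add[of x "- y"] by simp

lemma frob_divide [simp]: "\<sigma> (x / y) = \<sigma> x / \<sigma> y"
  by (simp add: \<sigma>_def power_divide)

text \<open>Iterates of \<sigma>, unlike powers with exponent \<open>q ^ i\<close>, are within reach
  of the simp rules for a single \<sigma>.\<close>

lemma power_eq_frob:
  "x ^ q = \<sigma> x" "x ^ (q ^ 2) = \<sigma> (\<sigma> x)" "x ^ (q ^ 3) = \<sigma> (\<sigma> (\<sigma> x))"
  "x ^ (q ^ 4) = \<sigma> (\<sigma> (\<sigma> (\<sigma> x)))"
  by (simp_all add: \<sigma>_def numeral_eq_Suc power_mult)

lemma frob_frob_frob_frob_frob [simp]: "\<sigma> (\<sigma> (\<sigma> (\<sigma> (\<sigma> x)))) = x"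
  using power_q5[of x] by (simp add: \<sigma>_def numeral_eq_Suc power_mult)

lemma Tr_eq_frob: "Tr q x = x + \<sigma> x + \<sigma> (\<sigma> x) + \<sigma> (\<sigma> (\<sigma> x)) + \<sigma> (\<sigma> (\<sigma> (\<sigma> x)))"
  by (simp add: Tr_def power_eq_frob)

lemma Fq_iff: "h \<in> Fq q \<longleftrightarrow> \<sigma> h = h"
  by (simp add: Fq_def \<sigma>_def)

lemma frob_Tr [simp]: "\<sigma> (Tr q x) = Tr q x"
  by (simp add: Tr_eq_frob algebra_simps)

lemma Tr_frob [simp]: "Tr q (\<sigma> x) = Tr q x"
  by (simp add: Tr_eq_frob algebra_simps)

lemma Tr_add [simp]: "Tr q (x + y) = Tr q x + Tr q y" for x y :: 'a
  by (simp add: Tr_eq_frob algebra_simps)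

lemma Tr_diff [simp]: "Tr q (x - y) = Tr q x - Tr q y" for x y :: 'a
  by (simp add: Tr_eq_frob algebra_simps)

lemma Tr_scale: "\<sigma> c = c \<Longrightarrow> Tr q (c * x) = c * Tr q x"
  by (simp add: Tr_eq_frob algebra_simps)

lemma Tr_of_fixed: "\<sigma> c = c \<Longrightarrow> Tr q c = 5 * c"
  by (simp add: Tr_eq_frob)

text \<open>Additive Hilbert 90, with a prescribed value of a trace functional not vanishing on \<open>F\<^sub>q\<close>.\<close>

lemma frob_diff_and_Tr_surj:
  assumes "Tr q \<rho> \<noteq> 0" "Tr q y = 0" "\<sigma> h = h"
  obtains x where "\<sigma> x - x = y" "Tr q (\<rho> * x) = h"
proof -
  \<comment> \<open>The coefficients are partial sums of the conjugates of \<open>y\<close>. Hence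
    \<open>z - \<sigma> z\<close> telescopes to \<open>y * Tr q \<rho>\<close>, the full sum
    \<open>Tr q y\<close> being zero.\<close>
  define z where "z = y * \<sigma> \<rho> + (y + \<sigma> y) * \<sigma> (\<sigma> \<rho>) + (y + \<sigma> y + \<sigma> (\<sigma> y)) * \<sigma> (\<sigma> (\<sigma> \<rho>))
    + (y + \<sigma> y + \<sigma> (\<sigma> y) + \<sigma> (\<sigma> (\<sigma> y))) * \<sigma> (\<sigma> (\<sigma> (\<sigma> \<rho>)))"
  have y4: "\<sigma> (\<sigma> (\<sigma> (\<sigma> y))) = - (y + \<sigma> y + \<sigma> (\<sigma> y) + \<sigma> (\<sigma> (\<sigma> y)))"
    using assms(2) by (simp add: Tr_eq_frob add_eq_0_iff)
  have z: "z - \<sigma> z = y * Tr q \<rho>"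
    by (simp add: z_def Tr_eq_frob y4 algebra_simps)
  define x0 where "x0 = - z / Tr q \<rho>"
  have x0: "\<sigma> x0 - x0 = y"
    using z assms(1) by (simp add: x0_def field_simps)
  \<comment> \<open>Adding an element fixed by \<sigma> preserves \<open>\<sigma> x0 - x0\<close>
    and shifts the trace by \<open>c * Tr q \<rho>\<close>.\<close>
  define c where "c = (h - Tr q (\<rho> * x0)) / Tr q \<rho>"
  have c: "\<sigma> c = c"
    by (simp add: c_def assms(3))
  have "Tr q (\<rho> * (x0 + c)) = h"
    using assms(1) Tr_scale[OF c, of \<rho>] by (simp add: distrib_left mult.commute) (simp add: c_def)
  moreover have "\<sigma> (x0 + c) - (x0 + c) = y"
    using x0 c by simp
  ultimately show ?thesis
    using that by blast
qed

section \<open>Reduction of both families to a common form\<close>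

definition V :: "'a \<Rightarrow> 'a \<Rightarrow> ('a ^ 2) set" where
  "V c \<gamma> = {vector [u, \<sigma> u + \<gamma> * t] | u t. \<sigma> t = t \<and> Tr q u = c * t}"

lemma V_eq_W:
  assumes "\<sigma> c = c" "\<gamma> \<noteq> 0"
  shows "\<exists>\<epsilon>\<in>{0, 1::nat}. \<exists>\<gamma>'. \<gamma>' \<noteq> 0 \<and> V c \<gamma> = W q \<epsilon> \<gamma>'"
proof (cases "c = 0")
  case True
  then have "V c \<gamma> = W q 0 \<gamma>"
    by (auto simp: V_def W_def W0_def Fq_iff power_eq_frob)
  then show ?thesis
    using assms(2) by blast
next
  case False
  have "t = Tr q u / c \<longleftrightarrow> Tr q u = c * t" for u t
    using False by (auto simp: field_simps)
  moreover have "\<sigma> (Tr q u / c) = Tr q u / c" for u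
    by (simp add: assms(1))
  ultimately have "\<sigma> t = t \<and> Tr q u = c * t \<longleftrightarrow> t = Tr q u / c" for u t
    by metis
  then have "V c \<gamma> = W q 1 (\<gamma> / c)"
    by (auto simp: V_def W_def W1_def power_eq_frob)
  then show ?thesis
    using assms(2) False by (metis divide_eq_0_iff insertCI)
qed

lemma C3_proj_equiv_V:
  assumes "\<eta> \<noteq> 0" "Tr q \<rho> \<noteq> 0"
  defines "e \<equiv> 1 / \<eta>"
  shows "proj_equiv (linear_set (U_C3 q \<eta> \<rho>)) (linear_set (V (Tr q e) (- (e + \<sigma> e))))"
proof (rule proj_equiv_linear_setI[where a = e and b = "-1" and c = "- e" and d = 0])
  have e: "e * \<eta> = 1" "e \<noteq> 0"
    using assms(1) by (simp_all add: e_def)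
  show "e * 0 - (- 1) * (- e) \<noteq> 0"
    using e by simp
  have coords:
    "e * (\<eta> * y + h) + (- 1) * (y + \<sigma> (\<sigma> (\<sigma> (\<sigma> y)))) = u"
    "(- e) * (\<eta> * y + h) + 0 * (y + \<sigma> (\<sigma> (\<sigma> (\<sigma> y)))) = \<sigma> u + - (e + \<sigma> e) * h"
    if "u = e * h - \<sigma> (\<sigma> (\<sigma> (\<sigma> y)))" "\<sigma> h = h" for u y h
  proof -
    have eq: "e * (\<eta> * y + h) = y + e * h"
      using e(1) by (simp add: distrib_left flip: mult.assoc)
    show "e * (\<eta> * y + h) + (- 1) * (y + \<sigma> (\<sigma> (\<sigma> (\<sigma> y)))) = u"
      unfolding eq that(1) by simp
    show "(- e) * (\<eta> * y + h) + 0 * (y + \<sigma> (\<sigma> (\<sigma> (\<sigma> y)))) = \<sigma> u + - (e + \<sigma> e) * h"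
      unfolding mult_minus_left eq that(1) using that(2) by (simp add: algebra_simps)
  qed
  \<comment> \<open>With \<open>y = \<sigma> x - x\<close>, applying \<sigma> four times gives
    \<open>x - \<sigma> (\<sigma> (\<sigma> (\<sigma> x)))\<close>, so the second coordinate depends
    on \<open>y\<close> alone.\<close>
  have U: "U_C3 q \<eta> \<rho> = {vector [\<eta> * y + h, y + \<sigma> (\<sigma> (\<sigma> (\<sigma> y)))] | y h. Tr q y = 0 \<and> \<sigma> h = h}"
    (is "_ = ?R")
  proof
    show "U_C3 q \<eta> \<rho> \<subseteq> ?R"
    proof
      fix v
      assume "v \<in> U_C3 q \<eta> \<rho>"
      then obtain x where
        "v = vector [\<eta> * (\<sigma> x - x) + Tr q (\<rho> * x), \<sigma> x - \<sigma> (\<sigma> (\<sigma> (\<sigma> x)))]"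
        by (auto simp: U_C3_def power_eq_frob)
      then have "v = vector [\<eta> * (\<sigma> x - x) + Tr q (\<rho> * x),
          (\<sigma> x - x) + \<sigma> (\<sigma> (\<sigma> (\<sigma> (\<sigma> x - x))))]"
        by simp
      moreover have "Tr q (\<sigma> x - x) = 0"
        by simp
      ultimately show "v \<in> ?R"
        using frob_Tr by blast
    qed
    show "?R \<subseteq> U_C3 q \<eta> \<rho>"
    proof
      fix v
      assume "v \<in> ?R"
      then obtain y h where v: "v = vector [\<eta> * y + h, y + \<sigma> (\<sigma> (\<sigma> (\<sigma> y)))]"
        and "Tr q y = 0" "\<sigma> h = h"
        by blast
      then obtain x where x: "\<sigma> x - x = y" "Tr q (\<rho> * x) = h"
        using frob_diff_and_Tr_surj assms(2) by metis
      have "y + \<sigma> (\<sigma> (\<sigma> (\<sigma> y))) = \<sigma> x - \<sigma> (\<sigma> (\<sigma> (\<sigma> x)))"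
        by (simp flip: x(1))
      then show "v \<in> U_C3 q \<eta> \<rho>"
        using v x by (auto simp: U_C3_def power_eq_frob)
    qed
  qed
  show "vector [e * x + (- 1) * y, (- e) * x + 0 * y] \<in> V (Tr q e) (- (e + \<sigma> e))"
    if xy: "vector [x, y] \<in> U_C3 q \<eta> \<rho>" for x y
  proof -
    from xy obtain z h where "vector [x, y] = (vector [\<eta> * z + h, z + \<sigma> (\<sigma> (\<sigma> (\<sigma> z)))] :: 'a ^ 2)"
      and h: "Tr q z = 0" "\<sigma> h = h"
      unfolding U by blast
    then have xy: "x = \<eta> * z + h" "y = z + \<sigma> (\<sigma> (\<sigma> (\<sigma> z)))"
      by (simp_all add: vec_eq_iff forall_2)
    define u where "u = e * h - \<sigma> (\<sigma> (\<sigma> (\<sigma> z)))"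
    have "Tr q u = Tr q e * h"
      using h Tr_scale[OF h(2), of e] by (simp add: u_def mult.commute)
    then show ?thesis
      unfolding xy coords[OF u_def h(2)] V_def using h(2) by blast
  qed
  show "\<exists>x y. vector [x, y] \<in> U_C3 q \<eta> \<rho> \<and> v = vector [e * x + (- 1) * y, (- e) * x + 0 * y]"
    if v: "v \<in> V (Tr q e) (- (e + \<sigma> e))" for v
  proof -
    from v obtain u h where v: "v = vector [u, \<sigma> u + - (e + \<sigma> e) * h]"
      and h: "\<sigma> h = h" "Tr q u = Tr q e * h"
      unfolding V_def by blast
    \<comment> \<open>Obtained by applying \<sigma> to the desired equation
      \<open>u = e * h - \<sigma> (\<sigma> (\<sigma> (\<sigma> y)))\<close>.\<close>
    define y where "y = \<sigma> e * h - \<sigma> u"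
    have u: "u = e * h - \<sigma> (\<sigma> (\<sigma> (\<sigma> y)))"
      using h by (simp add: y_def)
    have "Tr q y = 0"
      using h Tr_scale[OF h(1), of "\<sigma> e"] by (simp add: y_def mult.commute)
    then have "vector [\<eta> * y + h, y + \<sigma> (\<sigma> (\<sigma> (\<sigma> y)))] \<in> U_C3 q \<eta> \<rho>"
      unfolding U using h(1) by blast
    moreover have "v = vector [e * (\<eta> * y + h) + (- 1) * (y + \<sigma> (\<sigma> (\<sigma> (\<sigma> y)))),
        (- e) * (\<eta> * y + h) + 0 * (y + \<sigma> (\<sigma> (\<sigma> (\<sigma> y))))]"
      unfolding coords[OF u h(1)] by (rule v)
    ultimately show ?thesis
      by blast
  qed
qed

lemma C4_proj_equiv_V:
  assumes "k \<noteq> 1"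
  defines "\<delta> \<equiv> 1 / (k - 1)"
  shows "proj_equiv (linear_set (U_C4 q k)) (linear_set (V (2 + Tr q \<delta>) (- (1 + \<delta> + \<sigma> \<delta>))))"
\<comment> \<open>The first row produces \<open>u\<close>, the second \<open>- x - u\<close>; the
  determinant is \<delta>.\<close>
proof (rule proj_equiv_linear_setI[where a = \<delta> and b = \<delta> and c = "- 1 - \<delta>" and d = "- \<delta>"])
  have \<delta>: "\<delta> \<noteq> 0" "\<delta> * k = \<delta> + 1"
    using assms(1) by (auto simp: \<delta>_def field_simps)
  show "\<delta> * (- \<delta>) - \<delta> * (- 1 - \<delta>) \<noteq> 0"
    using \<delta> by (simp add: algebra_simps)
  define f where "f x = k * (\<sigma> x + \<sigma> (\<sigma> (\<sigma> x))) + \<sigma> (\<sigma> x) + \<sigma> (\<sigma> (\<sigma> (\<sigma> x)))" for x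
  have U: "U_C4 q k = {vector [x, f x] | x. True}"
    by (simp add: U_C4_def power_eq_frob f_def)
  define g where "g x = \<sigma> x + \<sigma> (\<sigma> (\<sigma> x)) + \<delta> * Tr q x" for x
  have g: "\<delta> * x + \<delta> * f x = g x" for x
  proof -
    have "\<delta> * x + \<delta> * f x = \<delta> * k * (\<sigma> x + \<sigma> (\<sigma> (\<sigma> x))) + \<delta> * (x + \<sigma> (\<sigma> x) + \<sigma> (\<sigma> (\<sigma> (\<sigma> x))))"
      by (simp add: f_def algebra_simps)
    then show ?thesis
      unfolding \<delta>(2) by (simp add: g_def Tr_eq_frob algebra_simps)
  qed
  have coords: "\<delta> * x + \<delta> * f x = g x"
    "(- 1 - \<delta>) * x + (- \<delta>) * f x = \<sigma> (g x) + - (1 + \<delta> + \<sigma> \<delta>) * Tr q x" for x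
  proof -
    \<comment> \<open>Outside the \<delta> terms, each of the five conjugates of \<open>x\<close>
      occurs exactly once.\<close>
    have "x + g x + \<sigma> (g x) = (1 + \<delta> + \<sigma> \<delta>) * Tr q x"
      unfolding g_def by (simp add: algebra_simps) (simp add: Tr_eq_frob)
    then have "- x - g x = \<sigma> (g x) - (1 + \<delta> + \<sigma> \<delta>) * Tr q x"
      by (simp add: algebra_simps)
    then show "(- 1 - \<delta>) * x + (- \<delta>) * f x = \<sigma> (g x) + - (1 + \<delta> + \<sigma> \<delta>) * Tr q x"
      using g[of x] by (simp add: algebra_simps)
  qed (rule g)
  show "vector [\<delta> * x + \<delta> * y, (- 1 - \<delta>) * x + (- \<delta>) * y]
      \<in> V (2 + Tr q \<delta>) (- (1 + \<delta> + \<sigma> \<delta>))"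
    if xy: "vector [x, y] \<in> U_C4 q k" for x y
  proof -
    have y: "y = f x"
      using xy by (auto simp: U vec_eq_iff forall_2)
    have "Tr q (g x) = (2 + Tr q \<delta>) * Tr q x"
      using Tr_scale[of "Tr q x" \<delta>] by (simp add: g_def algebra_simps)
    then show ?thesis
      unfolding y coords V_def using frob_Tr by blast
  qed
  show "\<exists>x y. vector [x, y] \<in> U_C4 q k
      \<and> v = vector [\<delta> * x + \<delta> * y, (- 1 - \<delta>) * x + (- \<delta>) * y]"
    if v: "v \<in> V (2 + Tr q \<delta>) (- (1 + \<delta> + \<sigma> \<delta>))" for v
  proof -
    from v obtain u t where v: "v = vector [u, \<sigma> u + - (1 + \<delta> + \<sigma> \<delta>) * t]"
      and t: "\<sigma> t = t" "Tr q u = (2 + Tr q \<delta>) * t"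
      unfolding V_def by blast
    \<comment> \<open>Forced by the identity for \<open>x + g x + \<sigma> (g x)\<close> once
      \<open>g x = u\<close> and \<open>Tr q x = t\<close> are required.\<close>
    define x where "x = t * (1 + \<delta> + \<sigma> \<delta>) - u - \<sigma> u"
    have "Tr q x = t * (5 + 2 * Tr q \<delta>) - 2 * Tr q u"
      using Tr_scale[OF t(1), of "1 + \<delta> + \<sigma> \<delta>"] Tr_of_fixed[of 1]
      by (simp add: x_def algebra_simps)
    then have x: "Tr q x = t"
      by (simp add: t(2) algebra_simps)
    have "g x = t * (2 + Tr q \<delta>) + u - Tr q u"
      unfolding g_def x by (simp add: x_def t(1) Tr_eq_frob algebra_simps)
    then have "g x = u"
      by (simp add: t(2))
    then have "v = vector [\<delta> * x + \<delta> * f x, (- 1 - \<delta>) * x + (- \<delta>) * f x]"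
      unfolding coords x v by simp
    then show ?thesis
      unfolding U by blast
  qed
qed

section \<open>Nonvanishing of the parameter \<gamma>\<close>

lemma C3_parameter_nonzero:
  assumes "\<eta> \<noteq> 0" "Tr q \<eta> = 0"
  shows "1 / \<eta> + \<sigma> (1 / \<eta>) \<noteq> 0"
proof
  assume "1 / \<eta> + \<sigma> (1 / \<eta>) = 0"
  moreover have "\<sigma> \<eta> \<noteq> 0"
    using assms(1) q_pos by (simp add: \<sigma>_def)
  ultimately have neg: "\<sigma> \<eta> = - \<eta>"
    using assms(1) by (simp add: field_simps eq_neg_iff_add_eq_0)
  \<comment> \<open>The five conjugates alternate in sign, leaving one \<eta> uncancelled.\<close>
  have "Tr q \<eta> = \<eta>"
    by (simp add: Tr_eq_frob neg)
  then show False
    using assms by simp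
qed

text \<open>Otherwise \<sigma> acts on \<delta> by the involution sending \<delta> to
  \<open>- 1 - \<delta>\<close>. Since its fifth iterate is the identity, \<delta> is fixed by it,
  which excludes characteristic 2 and forces \<open>k = - 1\<close>. The norm exponent is odd, so
  the norm would be \<open>- 1\<close>.\<close>

lemma C4_parameter_nonzero:
  assumes "Nm q k = 1" "k \<noteq> 1"
  shows "1 + 1 / (k - 1) + \<sigma> (1 / (k - 1)) \<noteq> 0"
proof
  define \<delta> where "\<delta> = 1 / (k - 1)"
  assume "1 + 1 / (k - 1) + \<sigma> (1 / (k - 1)) = 0"
  then have "1 + \<delta> + \<sigma> \<delta> = 0"
    by (simp only: \<delta>_def)
  then have s: "\<sigma> \<delta> = - 1 - \<delta>"
    by (simp add: algebra_simps eq_neg_iff_add_eq_0)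
  have "- 1 - \<delta> = \<delta>"
    using frob_frob_frob_frob_frob[of \<delta>] by (simp add: s)
  then have \<delta>: "2 * \<delta> = - 1"
    by (metis diff_add_cancel mult_2)
  then have two: "(2 :: 'a) \<noteq> 0"
    by auto
  have "\<delta> * (k - 1) = 1"
    using assms(2) by (simp add: \<delta>_def)
  then have "2 * \<delta> * (k - 1) = 2"
    by (simp only: mult.assoc mult_1_right)
  then have "- k = 1"
    by (simp add: \<delta>)
  then have k: "k = - 1"
    by (metis minus_minus)
  have "odd (1 + q + q ^ 2 + q ^ 3 + q ^ 4)"
    by simp
  then have "Nm q k = - 1"
    unfolding Nm_def k by (rule neg_one_odd_power)
  then have "(2 :: 'a) = 0"
    using assms(1) by (metis one_add_one add.right_inverse)
  then show False
    using two by simp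
qed

end

theorem proposition2p1:
  fixes q :: nat and U :: "('a::{field, finite} ^ 2) set"
  assumes "primepow q"
    and "CARD('a) = q ^ 5"
    and "Fq_subspace q U"
    and "linear_set U \<in> family_C3 q \<union> family_C4 q"
  shows "\<exists>\<epsilon>\<in>{0, 1::nat}. \<exists>\<gamma>::'a. \<gamma> \<noteq> 0 \<and> proj_equiv (linear_set U) (linear_set (W q \<epsilon> \<gamma>))"
proof -
  interpret quintic_frobenius q "\<lambda>x :: 'a. x ^ q"
  proof unfold_locales
    show "q > 0"
      using primepow_gt_0_nat assms(1) by blast
    show "(x + y) ^ q = x ^ q + y ^ q" for x y :: 'a
      using power_add_finite_field assms by blast
    show "x ^ (q ^ 5) = x" for x :: 'a
      using power_CARD_eq_self[of x] assms(2) by simp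
  qed
  \<comment> \<open>Both values of \<open>c\<close> are built from traces and integers, so they lie
    in the subfield of order \<open>q\<close>, as \<open>V_eq_W\<close> requires.\<close>
  have "\<exists>c \<gamma>. c ^ q = c \<and> \<gamma> \<noteq> 0 \<and> proj_equiv (linear_set U) (linear_set (V c \<gamma>))"
    using assms(4)
  proof
    assume "linear_set U \<in> family_C3 q"
    then obtain \<eta> \<rho> where "linear_set U = linear_set (U_C3 q \<eta> \<rho>)"
      and "\<eta> \<noteq> 0" "Tr q \<eta> = 0" "Tr q \<rho> \<noteq> 0"
      unfolding family_C3_def by blast
    then show ?thesis
      using C3_proj_equiv_V C3_parameter_nonzero frob_Tr by (metis neg_equal_0_iff_equal)
  next
    assume "linear_set U \<in> family_C4 q"
    then obtain k where "linear_set U = linear_set (U_C4 q k)" "Nm q k = 1" "k \<noteq> 1"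
      unfolding family_C4_def by blast
    moreover have "(2 + Tr q (1 / (k - 1))) ^ q = 2 + Tr q (1 / (k - 1))"
      by (simp only: frob_add frob_Tr frob_1 flip: one_add_one)
    ultimately show ?thesis
      using C4_proj_equiv_V C4_parameter_nonzero by (metis neg_equal_0_iff_equal)
  qed
  then show ?thesis
    using V_eq_W by metis
qed

end
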